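(* Let $\mu$ and $\nu$ be two probability measures on $(\mathbb{R},\mathcal B(\mathbb{R}))$ with finite first absolute moment, and let $G$ be a finite measure on $\mathbb{R}$, absolutely continuous with respect to Lebesgue measure, admitting a density $g$ of bounded variation. Then $$\|\mu*G-\nu*G\|_{TV}\le\frac{\|g\|_{BV}}{2}\,\mathcal W_1(\mu,\nu).$$
   Context: $\|\mu-\nu\|_{TV}=\sup_A|\mu(A)-\nu(A)|$ over Borel sets $A$. $\|g\|_{BV}=\sup\sum_{i=0}^{n-1}|g(x_{i+1})-g(x_i)|$ over all finite ordered subsets $x_0<\dots<x_n$ of $\mathbb{R}$; $g$ is of bounded variation if this is finite. $\mathcal W_1(\mu,\nu)=\inf\{\mathbb E|X-Y|:\mathscr L(X)=\mu,\mathscr L(Y)=\nu\}$, where $\mathscr L(\cdot)$ denotes the law of a random variable. *)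

theory Defs
  imports "HOL-Probability.Probability"
begin

definition tv_dist :: "real measure \<Rightarrow> real measure \<Rightarrow> ennreal" where
  "tv_dist M N = (SUP A \<in> sets borel. ennreal \<bar>measure M A - measure N A\<bar>)"

definition bv_norm :: "(real \<Rightarrow> real) \<Rightarrow> ennreal" where
  "bv_norm g = (SUP (n, x) \<in> {(n :: nat, x :: nat \<Rightarrow> real). strict_mono_on {..n} x}.
     ennreal (\<Sum>i<n. \<bar>g (x (Suc i)) - g (x i)\<bar>))"

definition bounded_variation :: "(real \<Rightarrow> real) \<Rightarrow> bool" where
  "bounded_variation g \<longleftrightarrow> bv_norm g < \<infinity>"

text \<open>
  HOL cannot quantify over all sample spaces of arbitrary type inside a definition, so the
  infimum runs over random variables defined on probability spaces whose points are pairs of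
  reals. This loses nothing: by \<open>wasserstein1_le\<close> below, a pair of random variables on a
  probability space of any type gives an upper bound.
\<close>
definition wasserstein1 :: "real measure \<Rightarrow> real measure \<Rightarrow> ennreal" where
  "wasserstein1 M N = Inf {\<integral>\<^sup>+\<omega>. ennreal \<bar>X \<omega> - Y \<omega>\<bar> \<partial>P | (P :: (real \<times> real) measure) X Y.
     prob_space P \<and> X \<in> borel_measurable P \<and> Y \<in> borel_measurable P \<and>
     distr P borel X = M \<and> distr P borel Y = N}"

lemma wasserstein1_le:
  fixes P :: "'a measure" and X Y :: "'a \<Rightarrow> real"
  assumes P: "prob_space P"
    and X [measurable]: "X \<in> borel_measurable P" and Y [measurable]: "Y \<in> borel_measurable P"
    and M: "distr P borel X = M" and N: "distr P borel Y = N"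
  shows "wasserstein1 M N \<le> (\<integral>\<^sup>+\<omega>. ennreal \<bar>X \<omega> - Y \<omega>\<bar> \<partial>P)"
proof -
  let ?Q = "distr P (borel \<Otimes>\<^sub>M borel) (\<lambda>\<omega>. (X \<omega>, Y \<omega>))"
  have "prob_space ?Q"
    by (rule prob_space.prob_space_distr[OF P]) measurable
  moreover have "distr ?Q borel fst = M" "distr ?Q borel snd = N"
    using M N by (subst distr_distr; simp add: comp_def)+
  moreover have "(\<integral>\<^sup>+\<omega>. ennreal \<bar>X \<omega> - Y \<omega>\<bar> \<partial>P) = (\<integral>\<^sup>+\<omega>. ennreal \<bar>fst \<omega> - snd \<omega>\<bar> \<partial>?Q)"
    by (subst nn_integral_distr) simp_all
  moreover have "fst \<in> borel_measurable ?Q" "snd \<in> borel_measurable ?Q"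
    by simp_all
  ultimately show ?thesis
    unfolding wasserstein1_def
    by (intro Inf_lower CollectI exI[of _ ?Q] exI[of _ fst] exI[of _ snd] conjI)
qed

end

theory Submission
  imports Defs
begin

text \<open>
  For every coupling \<open>(X, Y)\<close> of \<open>\<mu>\<close> and \<open>\<nu>\<close>, the difference \<open>(\<mu> \<star> G) A - (\<nu> \<star> G) A\<close> is the
  expectation of \<open>G (A - X) - G (A - Y)\<close>. Since the translates of \<open>G\<close> have equal total mass, the
  integrand is at most half the \<open>L\<^sup>1\<close> distance between two translates of \<open>g\<close>. This distance is
  bounded by the shift times the variation of \<open>g\<close>: cut the line into intervals of the length \<open>h\<close>
  of the shift; then \<open>\<integral> \<bar>g (z + h) - g z\<bar> dz\<close> becomes an integral over \<open>[0, h)\<close> of sums of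
  increments of \<open>g\<close> along the progressions \<open>z + h \<int>\<close>.
\<close>

section \<open>Variation and the L1 distance between translates of a function\<close>

lemma sum_increments_le_bv_norm:
  assumes "strict_mono_on {..n} x"
  shows "(\<Sum>i<n. ennreal \<bar>g (x (Suc i)) - g (x i)\<bar>) \<le> bv_norm g"
  using assms unfolding bv_norm_def
  by (subst sum_ennreal) (auto intro!: SUP_upper2[of "(n, x)"])

text \<open>The map \<open>max 0\<close> is 1-Lipschitz, so no increment grows. This allows a
  density that is nonnegative only almost everywhere to be replaced by one that is nonnegative
  everywhere.\<close>

lemma bv_norm_max_0_le: "bv_norm (\<lambda>x. max 0 (g x)) \<le> bv_norm g"
  unfolding bv_norm_def
  by (intro SUP_mono) (force intro!: ennreal_leI sum_mono)

lemma nn_integral_translate: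
  fixes f :: "real \<Rightarrow> ennreal"
  assumes "f \<in> borel_measurable borel"
  shows "(\<integral>\<^sup>+z. f (t + z) \<partial>lborel) = (\<integral>\<^sup>+z. f z \<partial>lborel)"
  using nn_integral_real_affine[OF assms, of 1 t] by simp

lemma nn_integral_increment_interval_le:
  fixes g :: "real \<Rightarrow> real"
  assumes [measurable]: "g \<in> borel_measurable borel" and h: "0 < h"
  shows "(\<integral>\<^sup>+z. ennreal \<bar>g (z + h) - g z\<bar> * indicator {a..<a + real n * h} z \<partial>lborel)
    \<le> bv_norm g * ennreal h"
proof -
  let ?f = "\<lambda>z. ennreal \<bar>g (z + h) - g z\<bar>"
  define t where "t k = a + real k * h" for k :: nat
  \<comment> \<open>For an upper bound it suffices that the \<open>n\<close> cells of length
    \<open>h\<close> cover the interval; the cell of \<open>z\<close> has the index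
    \<open>\<lfloor>(z - a) / h\<rfloor>\<close>.\<close>
  have cover: "indicator {a..<a + real n * h} z \<le> (\<Sum>k<n. indicator {t k..<t k + h} z :: ennreal)" for z
  proof (cases "z \<in> {a..<a + real n * h}")
    case True
    define k where "k = nat \<lfloor>(z - a) / h\<rfloor>"
    have "0 \<le> (z - a) / h" using True h by simp
    then have k: "real k \<le> (z - a) / h" "(z - a) / h < real k + 1"
      unfolding k_def by linarith+
    have "(z - a) / h < real n"
      using True h by (simp add: field_simps)
    then have "k < n" using k by linarith
    moreover have "z \<in> {t k..<t k + h}"
      using k h by (simp add: t_def field_simps)
    ultimately show ?thesis
      using sum_mono2[of "{..<n}" "{k}" "\<lambda>k. indicator {t k..<t k + h} z :: ennreal"] True by simp
  qed simp
  have mono: "strict_mono_on {..n} (\<lambda>i. t i + z)" for z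
    using h by (auto simp: strict_mono_on_def t_def)
  have "(\<integral>\<^sup>+z. ?f z * indicator {a..<a + real n * h} z \<partial>lborel)
      \<le> (\<integral>\<^sup>+z. (\<Sum>k<n. ?f z * indicator {t k..<t k + h} z) \<partial>lborel)"
    by (intro nn_integral_mono) (simp add: cover mult_left_mono flip: sum_distrib_left)
  also have "\<dots> = (\<Sum>k<n. \<integral>\<^sup>+z. ?f z * indicator {t k..<t k + h} z \<partial>lborel)"
    by (rule nn_integral_sum) simp
  also have "\<dots> = (\<Sum>k<n. \<integral>\<^sup>+z. ?f (t k + z) * indicator {t k..<t k + h} (t k + z) \<partial>lborel)"
    by (subst nn_integral_translate) simp_all
  also have "\<dots> = (\<Sum>k<n. \<integral>\<^sup>+z. ?f (t k + z) * indicator {0..<h} z \<partial>lborel)"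
    by (intro sum.cong nn_integral_cong refl) (simp add: indicator_def)
  also have "\<dots> = (\<integral>\<^sup>+z. (\<Sum>k<n. ?f (t k + z)) * indicator {0..<h} z \<partial>lborel)"
    unfolding sum_distrib_right by (rule nn_integral_sum[symmetric]) simp
  also have "\<dots> \<le> (\<integral>\<^sup>+z. bv_norm g * indicator {0..<h} z \<partial>lborel)"
  \<comment> \<open>As \<open>t (Suc k) = t k + h\<close>, the summands at a fixed \<open>z\<close>
    are the consecutive increments of \<open>g\<close> along the points \<open>t i + z\<close> with
    \<open>i \<le> n\<close>.\<close>
  proof (intro nn_integral_mono mult_right_mono)
    fix z
    show "(\<Sum>k<n. ?f (t k + z)) \<le> bv_norm g"
      using sum_increments_le_bv_norm[OF mono[of z], of g]
      by (simp add: t_def algebra_simps)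
  qed simp
  also have "\<dots> = bv_norm g * ennreal h"
    using h by (simp add: nn_integral_cmult)
  finally show ?thesis .
qed

text \<open>The bound on an interval does not depend on its length, so monotone convergence along
  growing windows carries it to the whole line.\<close>

lemma nn_integral_increment_le:
  fixes g :: "real \<Rightarrow> real"
  assumes [measurable]: "g \<in> borel_measurable borel" and h: "0 < h"
  shows "(\<integral>\<^sup>+z. ennreal \<bar>g (z + h) - g z\<bar> \<partial>lborel) \<le> bv_norm g * ennreal h"
proof -
  let ?f = "\<lambda>z. ennreal \<bar>g (z + h) - g z\<bar>"
  let ?W = "\<lambda>n::nat. {- (real n * h)..<real n * h}"
  \<comment> \<open>The symmetric window consists of \<open>2 * n\<close> cells that start at
    \<open>- (real n * h)\<close>.\<close>
  have W: "- (real n * h) + real (2 * n) * h = real n * h" for n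
    by simp
  have inc: "incseq (\<lambda>n z. ?f z * indicator (?W n) z)"
    unfolding incseq_def le_fun_def
  proof (intro allI impI mult_left_mono)
    fix m n :: nat and z :: real
    assume "m \<le> n"
    then have "real m * h \<le> real n * h" using h by simp
    then show "indicator (?W m) z \<le> (indicator (?W n) z :: ennreal)"
      by (auto simp: indicator_def)
  qed simp
  have lim: "(SUP n. ?f z * indicator (?W n) z) = ?f z" for z
  proof (rule antisym)
    obtain n :: nat where "\<bar>z\<bar> / h < real n"
      using reals_Archimedean2 by blast
    then have "z \<in> ?W n"
      using h by (auto simp: field_simps abs_less_iff)
    then show "?f z \<le> (SUP n. ?f z * indicator (?W n) z)"
      by (intro SUP_upper2[of n]) auto
  qed (auto intro!: SUP_least simp: indicator_def)
  have "(\<integral>\<^sup>+z. ?f z \<partial>lborel) = (\<integral>\<^sup>+z. (SUP n. ?f z * indicator (?W n) z) \<partial>lborel)"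
    by (simp only: lim)
  also have "\<dots> = (SUP n. \<integral>\<^sup>+z. ?f z * indicator (?W n) z \<partial>lborel)"
    by (rule nn_integral_monotone_convergence_SUP[OF inc]) simp
  also have "\<dots> \<le> bv_norm g * ennreal h"
    using nn_integral_increment_interval_le[OF assms, of "- (real n * h)" "2 * n" for n]
    by (intro SUP_least) (simp only: W)
  finally show ?thesis .
qed

lemma nn_integral_translates_diff_le:
  fixes g :: "real \<Rightarrow> real"
  assumes [measurable]: "g \<in> borel_measurable borel"
  shows "(\<integral>\<^sup>+z. ennreal \<bar>g (z - x) - g (z - y)\<bar> \<partial>lborel) \<le> bv_norm g * ennreal \<bar>x - y\<bar>"
proof (induction x y rule: linorder_wlog)
  case (le x y)
  have "(\<integral>\<^sup>+z. ennreal \<bar>g (z - x) - g (z - y)\<bar> \<partial>lborel)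
      = (\<integral>\<^sup>+z. ennreal \<bar>g (z + (y - x)) - g z\<bar> \<partial>lborel)"
    by (subst nn_integral_translate[of _ y, symmetric]) (simp_all add: algebra_simps)
  \<comment> \<open>The case \<open>x = y\<close> stands apart because the increment bound asks for
    a positive step; there both sides are 0.\<close>
  also have "\<dots> \<le> bv_norm g * ennreal \<bar>x - y\<bar>"
    using nn_integral_increment_le[of g "y - x"] le by (cases "x = y") simp_all
  finally show ?case .
qed (simp add: abs_minus_commute)

section \<open>From densities to the mass of translated sets\<close>

text \<open>The factor 2 is gained by comparing the integrals over \<open>A\<close> and over its complement.\<close>

lemma set_integral_diff_le_half:
  fixes p q :: "'a \<Rightarrow> real"
  assumes p: "integrable M p" and q: "integrable M q" and A: "A \<in> sets M"
    and eq: "(\<integral>z. p z \<partial>M) = (\<integral>z. q z \<partial>M)"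
  shows "2 * \<bar>(\<integral>z. indicator A z * p z \<partial>M) - (\<integral>z. indicator A z * q z \<partial>M)\<bar> \<le> (\<integral>z. \<bar>p z - q z\<bar> \<partial>M)"
proof -
  let ?d = "\<lambda>z. p z - q z"
  have d: "integrable M ?d" using p q by simp
  have ind: "integrable M (\<lambda>z. indicator A z * f z)" if "integrable M f" for f :: "'a \<Rightarrow> real"
    using integrable_mult_indicator[OF A that] by simp
  have dA: "integrable M (\<lambda>z. indicator A z * ?d z)" "integrable M (\<lambda>z. indicator A z * \<bar>?d z\<bar>)"
    and pq: "integrable M (\<lambda>z. indicator A z * p z)" "integrable M (\<lambda>z. indicator A z * q z)"
    using d p q by (simp_all add: ind)
  define D where "D = (\<integral>z. indicator A z * ?d z \<partial>M)"
  have "\<bar>D\<bar> \<le> (\<integral>z. \<bar>indicator A z * ?d z\<bar> \<partial>M)"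
    unfolding D_def by (rule integral_abs_bound)
  then have inside: "\<bar>D\<bar> \<le> (\<integral>z. indicator A z * \<bar>?d z\<bar> \<partial>M)"
    by (simp add: abs_mult)
  \<comment> \<open>By \<open>eq\<close> the integral of \<open>?d\<close> over the whole space is
    0, so the complement of \<open>A\<close> contributes \<open>- D\<close>. The two bounds on
    \<open>\<bar>D\<bar>\<close>, from \<open>A\<close> and from its complement, add up to the full
    L1 distance.\<close>
  have "(\<integral>z. ?d z - indicator A z * ?d z \<partial>M) = - D"
    using d dA p q eq by (simp add: D_def)
  then have "\<bar>D\<bar> \<le> (\<integral>z. \<bar>?d z - indicator A z * ?d z\<bar> \<partial>M)"
    using integral_abs_bound[of M "\<lambda>z. ?d z - indicator A z * ?d z"] by simp
  also have "\<dots> = (\<integral>z. \<bar>?d z\<bar> - indicator A z * \<bar>?d z\<bar> \<partial>M)"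
    by (intro Bochner_Integration.integral_cong) (auto simp: indicator_def)
  also have "\<dots> = (\<integral>z. \<bar>?d z\<bar> \<partial>M) - (\<integral>z. indicator A z * \<bar>?d z\<bar> \<partial>M)"
    using d dA by simp
  finally have "2 * \<bar>D\<bar> \<le> (\<integral>z. \<bar>?d z\<bar> \<partial>M)"
    using inside by simp
  moreover have "D = (\<integral>z. indicator A z * p z \<partial>M) - (\<integral>z. indicator A z * q z \<partial>M)"
    unfolding D_def using pq by (simp add: right_diff_distrib)
  ultimately show ?thesis by simp
qed

text \<open>The substitution \<open>z = x + y\<close> moves the shift from the set to the density,
  so that the masses of two translates of \<open>A\<close> become integrals of two functions over
  the same set.\<close>

lemma measure_density_translate:
  fixes g :: "real \<Rightarrow> real"
  assumes g: "integrable lborel g" "\<And>z. 0 \<le> g z" and [measurable]: "A \<in> sets borel"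
  shows "measure (density lborel (\<lambda>z. ennreal (g z))) {y. y + x \<in> A}
    = (\<integral>z. indicator A z * g (z - x) \<partial>lborel)"
proof -
  have [measurable]: "g \<in> borel_measurable borel" using g(1) by auto
  have S: "{y. y + x \<in> A} \<in> sets borel"
    using measurable_sets[of "\<lambda>y. y + x" borel borel A] by (simp add: vimage_def)
  have "emeasure (density lborel (\<lambda>z. ennreal (g z))) {y. y + x \<in> A}
      = (\<integral>\<^sup>+y. ennreal (g y) * indicator {y. y + x \<in> A} y \<partial>lborel)"
    using S by (simp add: emeasure_density)
  also have "\<dots> = (\<integral>\<^sup>+y. ennreal (indicator A (x + y) * g ((x + y) - x)) \<partial>lborel)"
    by (intro nn_integral_cong) (auto simp: indicator_def add.commute)
  also have "\<dots> = (\<integral>\<^sup>+z. ennreal (indicator A z * g (z - x)) \<partial>lborel)"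
    by (rule nn_integral_translate) simp
  finally show ?thesis
    using g(2) by (simp add: measure_def integral_eq_nn_integral)
qed

lemma measure_density_translates_diff_le:
  fixes g :: "real \<Rightarrow> real"
  assumes g: "integrable lborel g" "\<And>z. 0 \<le> g z" and A: "A \<in> sets borel"
  shows "ennreal \<bar>measure (density lborel (\<lambda>z. ennreal (g z))) {z. z + x \<in> A}
      - measure (density lborel (\<lambda>z. ennreal (g z))) {z. z + y \<in> A}\<bar>
    \<le> bv_norm g / 2 * ennreal \<bar>x - y\<bar>" (is "ennreal \<bar>?D\<bar> \<le> _")
proof -
  have m: "g \<in> borel_measurable borel" using g(1) by auto
  have int: "integrable lborel (\<lambda>z. g (z - t))" for t
    using lborel_integrable_real_affine[OF g(1), of 1 "- t"] by simp
  \<comment> \<open>Equal total mass of all translates is what the bound with the factor 2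
    requires.\<close>
  have tot: "(\<integral>z. g (z - t) \<partial>lborel) = (\<integral>z. g z \<partial>lborel)" for t
    using lborel_integral_real_affine[of 1 g "- t"] by simp
  have "2 * \<bar>?D\<bar> \<le> (\<integral>z. \<bar>g (z - x) - g (z - y)\<bar> \<partial>lborel)"
    using set_integral_diff_le_half[OF int int, of A x y] A g
    by (simp add: measure_density_translate tot)
  then have "ennreal (2 * \<bar>?D\<bar>) \<le> ennreal (\<integral>z. \<bar>g (z - x) - g (z - y)\<bar> \<partial>lborel)"
    by (rule ennreal_leI)
  also have "\<dots> = (\<integral>\<^sup>+z. ennreal \<bar>g (z - x) - g (z - y)\<bar> \<partial>lborel)"
    using int by (intro nn_integral_eq_integral[symmetric]) simp_all
  also have "\<dots> \<le> bv_norm g * ennreal \<bar>x - y\<bar>"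
    by (rule nn_integral_translates_diff_le[OF m])
  finally have "ennreal (2 * \<bar>?D\<bar>) / 2 \<le> bv_norm g * ennreal \<bar>x - y\<bar> / 2"
    by (rule divide_right_mono_ennreal)
  then show ?thesis
    by (simp add: ennreal_divide_numeral ennreal_times_divide mult.commute)
qed

section \<open>Values of a convolution as expectations over a coupling\<close>

text \<open>The sets \<open>{y. y + x \<in> A}\<close> are the sections of a measurable subset of
  the plane, and their mass under a finite measure depends measurably on \<open>x\<close>.\<close>

lemma borel_measurable_measure_translate:
  assumes "finite_measure G" and sG [measurable_cong]: "sets G = sets borel"
    and [measurable]: "A \<in> sets borel"
  shows "(\<lambda>x. measure G {y. y + x \<in> A}) \<in> borel_measurable (borel :: real measure)"
proof -
  interpret finite_measure G by fact
  have "space G = UNIV" using sets_eq_imp_space_eq[OF sG] by simp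
  then have "(\<lambda>x. measure G {y \<in> space G. y + x \<in> A}) \<in> borel_measurable borel"
    by measurable
  then show ?thesis using \<open>space G = UNIV\<close> by simp
qed

text \<open>The formula for \<open>emeasure\<close> becomes one for real integrals, so that two
  convolutions can be subtracted. The integrand is bounded by the total mass of \<open>G\<close>,
  hence integrable over the finite measure \<open>M\<close>.\<close>

lemma measure_convolution:
  fixes M G :: "real measure"
  assumes M: "finite_measure M" and sM: "sets M = sets borel"
    and G: "finite_measure G" and sG: "sets G = sets borel" and A: "A \<in> sets borel"
  shows "integrable M (\<lambda>x. measure G {y. y + x \<in> A})"
    and "measure (M \<star> G) A = (\<integral>x. measure G {y. y + x \<in> A} \<partial>M)"
proof -
  interpret M: finite_measure M by fact
  interpret G: finite_measure G by fact
  have sp: "space M = space G" "space G = space borel"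
    using sets_eq_imp_space_eq[OF sM] sets_eq_imp_space_eq[OF sG] by simp_all
  have [measurable]: "(\<lambda>x. measure G {y. y + x \<in> A}) \<in> borel_measurable M"
    using borel_measurable_measure_translate[OF G sG A] sM by (simp cong: measurable_cong_sets)
  show "integrable M (\<lambda>x. measure G {y. y + x \<in> A})"
    by (rule M.integrable_const_bound[of _ "measure G (space G)"])
      (auto intro: G.bounded_measure)
  have "emeasure (M \<star> G) A = (\<integral>\<^sup>+x. ennreal (measure G {y. y + x \<in> A}) \<partial>M)"
    using convolution_emeasure[OF A M G sG sM sp] by (simp add: G.emeasure_eq_measure)
  then show "measure (M \<star> G) A = (\<integral>x. measure G {y. y + x \<in> A} \<partial>M)"
    by (simp add: measure_def[of "M \<star> G"] integral_eq_nn_integral)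
qed

lemma tv_dist_convolution_le_coupling:
  fixes \<mu> \<nu> :: "real measure" and P :: "'a measure" and g :: "real \<Rightarrow> real"
  assumes "prob_space \<mu>" and s\<mu>: "sets \<mu> = sets borel"
    and "prob_space \<nu>" and s\<nu>: "sets \<nu> = sets borel"
    and g: "integrable lborel g" "\<And>z. 0 \<le> g z"
    and X [measurable]: "X \<in> borel_measurable P" and Y [measurable]: "Y \<in> borel_measurable P"
    and \<mu>: "distr P borel X = \<mu>" and \<nu>: "distr P borel Y = \<nu>"
  defines "G \<equiv> density lborel (\<lambda>z. ennreal (g z))"
  shows "tv_dist (\<mu> \<star> G) (\<nu> \<star> G) \<le> bv_norm g / 2 * (\<integral>\<^sup>+\<omega>. ennreal \<bar>X \<omega> - Y \<omega>\<bar> \<partial>P)"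
  unfolding tv_dist_def
proof (rule SUP_least)
  interpret \<mu>: prob_space \<mu> by fact
  interpret \<nu>: prob_space \<nu> by fact
  fix A :: "real set" assume A: "A \<in> sets borel"
  have G: "finite_measure G"
  proof
    have "emeasure G (space G) = (\<integral>\<^sup>+z. ennreal (g z) \<partial>lborel)"
      using g(1) by (auto simp: G_def emeasure_density)
    also have "\<dots> < \<infinity>"
      using g by (simp add: nn_integral_eq_integral)
    finally show "emeasure G (space G) \<noteq> \<infinity>" by simp
  qed
  have sG: "sets G = sets borel" by (simp add: G_def)
  let ?F = "\<lambda>x. measure G {y. y + x \<in> A}"
  have F [measurable]: "?F \<in> borel_measurable borel"
    by (rule borel_measurable_measure_translate[OF G sG A])
  note conv\<mu> = measure_convolution[OF \<mu>.finite_measure_axioms s\<mu> G sG A]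
  note conv\<nu> = measure_convolution[OF \<nu>.finite_measure_axioms s\<nu> G sG A]
  have int: "integrable P (\<lambda>\<omega>. ?F (X \<omega>))" "integrable P (\<lambda>\<omega>. ?F (Y \<omega>))"
    using conv\<mu>(1) conv\<nu>(1) unfolding \<mu>[symmetric] \<nu>[symmetric]
    by (simp_all add: integrable_distr_eq)
  \<comment> \<open>Both integrals are pulled back along \<open>X\<close> and \<open>Y\<close> to
    the common space \<open>P\<close>, where the difference can be bounded pointwise.\<close>
  have "measure (\<mu> \<star> G) A - measure (\<nu> \<star> G) A = (\<integral>\<omega>. ?F (X \<omega>) - ?F (Y \<omega>) \<partial>P)"
    unfolding conv\<mu>(2) conv\<nu>(2) unfolding \<mu>[symmetric] \<nu>[symmetric]
    using int by (simp add: integral_distr)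
  then have "ennreal \<bar>measure (\<mu> \<star> G) A - measure (\<nu> \<star> G) A\<bar>
      \<le> (\<integral>\<^sup>+\<omega>. ennreal \<bar>?F (X \<omega>) - ?F (Y \<omega>)\<bar> \<partial>P)"
    using integral_norm_bound_ennreal[of P "\<lambda>\<omega>. ?F (X \<omega>) - ?F (Y \<omega>)"] int by simp
  also have "\<dots> \<le> (\<integral>\<^sup>+\<omega>. bv_norm g / 2 * ennreal \<bar>X \<omega> - Y \<omega>\<bar> \<partial>P)"
    unfolding G_def by (intro nn_integral_mono measure_density_translates_diff_le g A)
  also have "\<dots> = bv_norm g / 2 * (\<integral>\<^sup>+\<omega>. ennreal \<bar>X \<omega> - Y \<omega>\<bar> \<partial>P)"
    by (simp add: nn_integral_cmult)
  finally show "ennreal \<bar>measure (\<mu> \<star> G) A - measure (\<nu> \<star> G) A\<bar>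
      \<le> bv_norm g / 2 * (\<integral>\<^sup>+\<omega>. ennreal \<bar>X \<omega> - Y \<omega>\<bar> \<partial>P)" .
qed

section \<open>Passage to the infimum over all couplings\<close>

text \<open>The independent coupling: the product measure with its two projections. It keeps the
  infimum in \<open>wasserstein1\<close> from running over the empty set.\<close>

lemma ex_coupling:
  fixes \<mu> \<nu> :: "real measure"
  assumes "prob_space \<mu>" and s\<mu> [measurable_cong]: "sets \<mu> = sets borel"
    and "prob_space \<nu>" and s\<nu> [measurable_cong]: "sets \<nu> = sets borel"
  shows "\<exists>(P :: (real \<times> real) measure) X Y. prob_space P \<and> X \<in> borel_measurable P \<and>
    Y \<in> borel_measurable P \<and> distr P borel X = \<mu> \<and> distr P borel Y = \<nu>"
proof (intro exI conjI)
  interpret \<mu>: prob_space \<mu> by fact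
  interpret \<nu>: prob_space \<nu> by fact
  interpret pair_prob_space \<mu> \<nu> ..
  show "prob_space (\<mu> \<Otimes>\<^sub>M \<nu>)" by unfold_locales
  show "fst \<in> borel_measurable (\<mu> \<Otimes>\<^sub>M \<nu>)" "snd \<in> borel_measurable (\<mu> \<Otimes>\<^sub>M \<nu>)"
    by measurable
  have "distr (\<mu> \<Otimes>\<^sub>M \<nu>) borel fst = distr (\<mu> \<Otimes>\<^sub>M \<nu>) \<mu> fst"
    by (rule distr_cong) (simp_all add: s\<mu>)
  then show "distr (\<mu> \<Otimes>\<^sub>M \<nu>) borel fst = \<mu>"
    by (simp add: \<nu>.distr_pair_fst)
  \<comment> \<open>Swapping the factors reduces the second marginal to the first one.\<close>
  have "distr (\<mu> \<Otimes>\<^sub>M \<nu>) borel snd = distr (\<nu> \<Otimes>\<^sub>M \<mu>) \<nu> fst"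
    by (subst distr_pair_swap, subst distr_distr) (auto simp: s\<nu> comp_def case_prod_unfold intro!: distr_cong)
  then show "distr (\<mu> \<Otimes>\<^sub>M \<nu>) borel snd = \<nu>"
    by (simp add: \<mu>.distr_pair_fst)
qed

text \<open>For \<open>0 < b < \<infinity>\<close> one can divide by \<open>b\<close> and take the
  infimum. The value \<open>\<infinity>\<close> has to be excluded: if \<open>S\<close> consists of
  positive numbers with infimum 0, then \<open>\<infinity> * Inf S = 0\<close>, although
  \<open>\<infinity> * c = \<infinity>\<close> for each \<open>c\<close> in
  \<open>S\<close>.\<close>

lemma le_mult_InfI_ennreal:
  fixes a b :: ennreal
  assumes "S \<noteq> {}" and "b \<noteq> \<infinity>" and le: "\<And>c. c \<in> S \<Longrightarrow> a \<le> b * c"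
  shows "a \<le> b * Inf S"
proof (cases "b = 0")
  case True
  \<comment> \<open>Any element \<open>c\<close> of the nonempty \<open>S\<close> gives
    \<open>a \<le> 0 * c = 0\<close>.\<close>
  then show ?thesis using assms by auto
next
  case False
  then have "a / b \<le> Inf S"
    using le by (intro Inf_greatest divide_le_posI_ennreal) (auto simp: zero_less_iff_neq_zero)
  then have "b * (a / b) \<le> b * Inf S"
    by (rule mult_left_mono) simp
  then show ?thesis
    using False \<open>b \<noteq> \<infinity>\<close>
    by (simp add: ennreal_times_divide mult.commute mult_divide_eq_ennreal)
qed

theorem proposition4:
  fixes \<mu> \<nu> G :: "real measure" and g :: "real \<Rightarrow> real"
  assumes "prob_space \<mu>" and "sets \<mu> = sets borel" and "integrable \<mu> (\<lambda>x. \<bar>x\<bar>)"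
    and "prob_space \<nu>" and "sets \<nu> = sets borel" and "integrable \<nu> (\<lambda>x. \<bar>x\<bar>)"
    and "finite_measure G" and "sets G = sets borel"
    and "absolutely_continuous lborel G"
    and "g \<in> borel_measurable borel" and "AE x in lborel. 0 \<le> g x"
    and "G = density lborel (\<lambda>x. ennreal (g x))"
    and "bounded_variation g"
  shows "tv_dist (\<mu> \<star> G) (\<nu> \<star> G) \<le> bv_norm g / 2 * wasserstein1 \<mu> \<nu>"
proof -
  interpret G: finite_measure G by fact
  \<comment> \<open>Truncation makes the density nonnegative everywhere and leaves \<open>G\<close>
    unchanged, because \<open>ennreal\<close> sends negative numbers to 0.\<close>
  let ?g = "\<lambda>z. max 0 (g z)"
  have G: "G = density lborel (\<lambda>z. ennreal (?g z))"
    using assms(12) by (simp add: ennreal_max_0)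
  \<comment> \<open>The integral of the density is the total mass of \<open>G\<close>, so finiteness
    of \<open>G\<close> yields integrability.\<close>
  have "(\<integral>\<^sup>+z. ennreal (?g z) \<partial>lborel) = emeasure G (space G)"
    unfolding G using assms(10) by (simp add: emeasure_density)
  also have "\<dots> < \<infinity>"
    using G.emeasure_finite[of "space G"] unfolding infinity_ennreal_def less_top .
  finally have g: "integrable lborel ?g"
    using assms(10) by (intro integrableI_nonneg) simp_all
  have V: "bv_norm g \<noteq> \<infinity>"
    using assms(13) by (simp add: bounded_variation_def)
  show ?thesis
    unfolding wasserstein1_def
  proof (rule le_mult_InfI_ennreal)
    show "bv_norm g / 2 \<noteq> \<infinity>"
      using V by (simp add: ennreal_divide_eq_top_iff)
    show "{\<integral>\<^sup>+\<omega>. ennreal \<bar>X \<omega> - Y \<omega>\<bar> \<partial>P | (P :: (real \<times> real) measure) X Y.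
      prob_space P \<and> X \<in> borel_measurable P \<and> Y \<in> borel_measurable P \<and>
      distr P borel X = \<mu> \<and> distr P borel Y = \<nu>} \<noteq> {}"
      using ex_coupling[OF assms(1,2,4,5)] by blast
  next
    fix c
    assume "c \<in> {\<integral>\<^sup>+\<omega>. ennreal \<bar>X \<omega> - Y \<omega>\<bar> \<partial>P | (P :: (real \<times> real) measure) X Y.
      prob_space P \<and> X \<in> borel_measurable P \<and> Y \<in> borel_measurable P \<and>
      distr P borel X = \<mu> \<and> distr P borel Y = \<nu>}"
    then obtain P :: "(real \<times> real) measure" and X Y where c: "c = (\<integral>\<^sup>+\<omega>. ennreal \<bar>X \<omega> - Y \<omega>\<bar> \<partial>P)"
      and XY: "X \<in> borel_measurable P" "Y \<in> borel_measurable P"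
        "distr P borel X = \<mu>" "distr P borel Y = \<nu>"
      by blast
    have "tv_dist (\<mu> \<star> G) (\<nu> \<star> G) \<le> bv_norm ?g / 2 * c"
      unfolding G c
      by (rule tv_dist_convolution_le_coupling[OF assms(1,2,4,5) g _ XY]) simp
    also have "\<dots> \<le> bv_norm g / 2 * c"
      by (intro mult_right_mono divide_right_mono_ennreal bv_norm_max_0_le) simp
    finally show "tv_dist (\<mu> \<star> G) (\<nu> \<star> G) \<le> bv_norm g / 2 * c" .
  qed
qed

end
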